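(* Fix $r\ge3$ and suppose $n^{-2/r}(\log n)^{1/\binom r2}\ll p\ll n^{-2/(r+1)}$. If $Y$ is the number of vertices of $G(n,p)$ lying in no copy of $K_r$, then, uniformly for integers $1\le t=o(n)$, $$\mathbb P(Y\ge t)=\exp\!\left(-(1+o(1))\,t\binom{n-1}{r-1}p^{\binom r2}\right).$$ Taking $t=s+1$ gives the following lower bound: for every non-negative integer $s=s(n)=o(n)$ with $n-s\in r\mathbb Z$, $$\mathbb P\bigl(\phi_r^s(G(n,p))=0\bigr)\ge\exp\!\left(-O_r\!\left((s+1)\frac{\mu_r(n,p)}{n}\right)\right).$$
   Context: All asymptotics are as $n\to\infty$; $p=p(n)$; $f\ll g$ means $f/g\to0$. $G(n,p)$ is the binomial random graph on $[n]$. "Uniformly for $1\le t=o(n)$" means: for every function $t_0(n)=o(n)$ the $o(1)$ term tends to $0$ uniformly over integers $1\le t\le t_0(n)$. For a graph $G$ on $n$ vertices, $\phi_r^s(G)$ is the number of collections of $(n-s)/r$ pairwise vertex-disjoint copies of $K_r$ in $G$. $\mu_r(n,p):=\binom nr p^{\binom r2}$. $O_r(\cdot)$ hides a constant depending only on $r$, for sufficiently large $n$. *)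

theory Defs
  imports
    "HOL-Probability.Probability"
    "HOL-Library.Ramsey"
    "HOL-Library.Landau_Symbols"
begin

text \<open>A graph on \<open>[n] = {1..n}\<close> is given by its edge set, a set of 2-element subsets of
  \<open>{1..n}\<close>. In \<open>G(n,p)\<close> every pair is an edge independently with probability \<open>p\<close>.\<close>

definition gnp :: "nat \<Rightarrow> real \<Rightarrow> nat set set pmf" where
  "gnp n p = map_pmf (\<lambda>f. {e \<in> nsets {1..n} 2. f e})
     (Pi_pmf (nsets {1..n} 2) False (\<lambda>_. bernoulli_pmf p))"

text \<open>A copy of \<open>K\<^sub>r\<close> is determined by its vertex set, so copies are represented by \<open>r\<close>-subsets of
  \<open>{1..n}\<close> all of whose pairs are edges.\<close>

definition Kr_copies :: "nat \<Rightarrow> nat \<Rightarrow> nat set set \<Rightarrow> nat set set" where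
  "Kr_copies r n E = {S \<in> nsets {1..n} r. nsets S 2 \<subseteq> E}"

definition uncovered :: "nat \<Rightarrow> nat \<Rightarrow> nat set set \<Rightarrow> nat" where
  "uncovered r n E = card {v \<in> {1..n}. \<not> (\<exists>S \<in> Kr_copies r n E. v \<in> S)}"

text \<open>The number \<open>\<phi>\<close> of partial \<open>K\<^sub>r\<close>-factors leaving exactly \<open>s\<close> vertices uncovered. It is only
  meaningful for \<open>s \<le> n\<close> and \<open>r dvd n - s\<close>, when neither \<open>-\<close> nor \<open>div\<close> truncates.\<close>

definition num_factors :: "nat \<Rightarrow> nat \<Rightarrow> nat \<Rightarrow> nat set set \<Rightarrow> nat" where
  "num_factors r s n E =
     card {M. M \<subseteq> Kr_copies r n E \<and> disjoint M \<and> card M = (n - s) div r}"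

definition mu :: "nat \<Rightarrow> nat \<Rightarrow> real \<Rightarrow> real" where
  "mu r n p = real (n choose r) * p ^ (r choose 2)"

end

theory Submission
  imports Defs
begin

text \<open>Write \<open>q = p ^ (r choose 2)\<close> for the probability that a given \<open>r\<close>-set spans a clique, and
\<open>\<lambda> = ((n - 1) choose (r - 1)) * q\<close> for the mean number of cliques at a given vertex. There are at
least \<open>t\<close> uncovered vertices exactly if some \<open>t\<close>-set \<open>T\<close> is such that no \<open>r\<close>-set meeting \<open>T\<close>
spans a clique. As \<open>t = o(n)\<close>, the number of \<open>r\<close>-sets meeting \<open>T\<close> is
\<open>(1 + o(1)) * t * ((n - 1) choose (r - 1))\<close>, the sets meeting \<open>T\<close> twice being negligible. The
theorem says that these sets fail to be cliques almost as if they did so independently, and that the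
choice of \<open>T\<close> does not matter on the exponential scale.

For the lower bound fix one set \<open>T\<close>. The events ``this \<open>r\<close>-set is not a clique'' are all decreasing
in the edges, hence positively correlated by Harris's inequality (\<open>Harris_prod\<close>). So the probability
that none of them is a clique is at least the product of the factors \<open>1 - q\<close>. There are at most
\<open>t * ((n - 1) choose (r - 1))\<close> factors, which gives at least \<open>exp (- (1 + O(q)) * t * \<lambda>)\<close>, and
\<open>q \<rightarrow> 0\<close>.

For the upper bound take the union over all \<open>T\<close>. There are at most \<open>n ^ t = exp (t * ln n)\<close> of them,
and the lower bound on \<open>p\<close> says \<open>ln n = o(\<lambda>)\<close>, so the union costs only a factor
\<open>exp (o(t * \<lambda>))\<close>. For a single \<open>T\<close> the inequality \<open>Janson\<close> applies. Its correction term is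
at most \<open>overlap_weight\<close> times the mean, where \<open>overlap_weight\<close> bounds the expected number of
further cliques that share an edge with a given clique. The upper bound on \<open>p\<close>, which says
\<open>n * p powr ((r + 1) / 2) \<rightarrow> 0\<close>, is just what makes this tend to \<open>0\<close>: the extreme
overlap is a single shared edge, where \<open>n ^ (r - 2) * p ^ ((r choose 2) - 1)\<close> is the \<open>(r - 2)\<close>-th
power of that quantity.

For the bound on \<open>num_factors\<close>, a family of \<open>(n - s) / r\<close> disjoint cliques covers \<open>n - s\<close> vertices,
so it cannot exist once \<open>s + 1\<close> vertices are uncovered. Since \<open>\<lambda> = r * mu / n\<close>, the lower bound
with \<open>t = s + 1\<close> gives the claim with constant \<open>2 * r\<close>, the factor \<open>2\<close> absorbing \<open>1 + O(q)\<close>.\<close>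

section \<open>Correlation inequalities for independent Bernoulli coordinates\<close>

definition increasing :: "('a \<Rightarrow> bool) set \<Rightarrow> bool" where
  "increasing U \<longleftrightarrow> (\<forall>f g. f \<in> U \<longrightarrow> f \<le> g \<longrightarrow> g \<in> U)"

abbreviation bern_prod :: "'a set \<Rightarrow> real \<Rightarrow> ('a \<Rightarrow> bool) pmf" where
  "bern_prod A p \<equiv> Pi_pmf A False (\<lambda>_. bernoulli_pmf p)"

definition all_on :: "'a set \<Rightarrow> ('a \<Rightarrow> bool) set" where
  "all_on F = {f. \<forall>e\<in>F. f e}"

text \<open>Conditioning on one coordinate: the step of every induction over the coordinate set below.\<close>

lemma prob_bern_prod_insert:
  assumes "finite A" "x \<notin> A" "0 \<le> p" "p \<le> 1"
  shows "measure_pmf.prob (bern_prod (insert x A) p) U =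
    p * measure_pmf.prob (bern_prod A p) {f. f(x := True) \<in> U}
    + (1 - p) * measure_pmf.prob (bern_prod A p) {f. f(x := False) \<in> U}"
proof -
  have "bern_prod (insert x A) p =
      bernoulli_pmf p \<bind> (\<lambda>y. map_pmf (\<lambda>f. f(x := y)) (bern_prod A p))"
    by (subst Pi_pmf_insert') (use assms in \<open>auto simp: map_pmf_def\<close>)
  then have "emeasure (measure_pmf (bern_prod (insert x A) p)) U =
      (\<integral>\<^sup>+ y. emeasure (measure_pmf (map_pmf (\<lambda>f. f(x := y)) (bern_prod A p))) U \<partial>bernoulli_pmf p)"
    by (simp only: emeasure_bind_pmf)
  also have "\<dots> =
      ennreal (measure_pmf.prob (bern_prod A p) {f. f(x := True) \<in> U}) * ennreal p
      + ennreal (measure_pmf.prob (bern_prod A p) {f. f(x := False) \<in> U}) * ennreal (1 - p)"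
    using assms by (simp add: vimage_def measure_pmf.emeasure_eq_measure)
  also have "\<dots> = ennreal (p * measure_pmf.prob (bern_prod A p) {f. f(x := True) \<in> U}
      + (1 - p) * measure_pmf.prob (bern_prod A p) {f. f(x := False) \<in> U})"
    using assms by (subst ennreal_plus) (auto simp: ennreal_mult mult.commute)
  finally show ?thesis
    using assms by (intro measure_eq_emeasure_eq_ennreal) auto
qed

text \<open>Induction over the coordinates. Both sections of an increasing event at \<open>x\<close> are increasing, and the
section at \<open>True\<close> contains the one at \<open>False\<close>. Hence the two conditional probabilities are ordered
the same way for \<open>U\<close> and for \<open>V\<close>, and what remains is Chebyshev's sum inequality for the two values
of coordinate \<open>x\<close>.\<close>

lemma Harris_increasing:
  assumes "finite A" "0 \<le> p" "p \<le> 1" "increasing U" "increasing V"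
  shows "measure_pmf.prob (bern_prod A p) U * measure_pmf.prob (bern_prod A p) V
    \<le> measure_pmf.prob (bern_prod A p) (U \<inter> V)"
  using assms(1,4,5)
proof (induction A arbitrary: U V)
  case empty
  then show ?case by (auto simp: indicator_def)
next
  case (insert x A)
  let ?P = "measure_pmf.prob (bern_prod A p)"
  define sec where "sec W y = {f. f(x := y) \<in> W}" for W :: "('a \<Rightarrow> bool) set" and y
  have inc: "increasing (sec W y)" if "increasing W" for W y
    unfolding increasing_def
  proof (intro allI impI)
    fix f g assume "f \<in> sec W y" "f \<le> g"
    moreover from this have "f(x := y) \<le> g(x := y)" by (simp add: le_fun_def)
    ultimately show "g \<in> sec W y" using that unfolding increasing_def sec_def by blast
  qed
  have sub: "?P (sec W False) \<le> ?P (sec W True)" if "increasing W" for W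
  proof (intro measure_pmf.finite_measure_mono subsetI)
    fix f assume "f \<in> sec W False"
    moreover have "f(x := False) \<le> f(x := True)" by (simp add: le_fun_def)
    ultimately show "f \<in> sec W True" using that unfolding increasing_def sec_def by blast
  qed auto
  have Int: "sec (U \<inter> V) y = sec U y \<inter> sec V y" for y by (auto simp: sec_def)
  have step: "measure_pmf.prob (bern_prod (insert x A) p) W
      = p * ?P (sec W True) + (1 - p) * ?P (sec W False)" for W
    unfolding sec_def by (rule prob_bern_prod_insert) (use insert assms in auto)
  \<comment> \<open>The left side of the next estimate falls short of the right side by exactly this product.\<close>
  have "0 \<le> p * (1 - p) * ((?P (sec U True) - ?P (sec U False)) * (?P (sec V True) - ?P (sec V False)))"
    using assms sub insert.prems by (intro mult_nonneg_nonneg) auto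
  then have "(p * ?P (sec U True) + (1 - p) * ?P (sec U False)) * (p * ?P (sec V True) + (1 - p) * ?P (sec V False))
      \<le> p * (?P (sec U True) * ?P (sec V True)) + (1 - p) * (?P (sec U False) * ?P (sec V False))"
    by (simp add: algebra_simps power2_eq_square)
  also have "\<dots> \<le> p * ?P (sec (U \<inter> V) True) + (1 - p) * ?P (sec (U \<inter> V) False)"
    unfolding Int using assms inc insert.prems insert.IH by (intro add_mono mult_left_mono) auto
  finally show ?case unfolding step .
qed

lemma prob_Compl: "measure_pmf.prob M (- U) = 1 - measure_pmf.prob M U"
  using measure_pmf.prob_compl[of U M] by (simp add: Compl_eq_Diff_UNIV)

lemma Harris_mixed:
  assumes "finite A" "0 \<le> p" "p \<le> 1" "increasing U" "increasing V"
  shows "measure_pmf.prob (bern_prod A p) (U - V)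
    \<le> measure_pmf.prob (bern_prod A p) U * measure_pmf.prob (bern_prod A p) (- V)"
proof -
  have "measure_pmf.prob (bern_prod A p) (U - V) =
     measure_pmf.prob (bern_prod A p) U - measure_pmf.prob (bern_prod A p) (U \<inter> V)"
    using measure_pmf.finite_measure_Diff'[of U _ V] by simp
  then show ?thesis using Harris_increasing[OF assms] by (simp add: prob_Compl algebra_simps)
qed

lemma Harris_decreasing:
  assumes "finite A" "0 \<le> p" "p \<le> 1" "increasing U" "increasing V"
  shows "measure_pmf.prob (bern_prod A p) (- U) * measure_pmf.prob (bern_prod A p) (- V)
    \<le> measure_pmf.prob (bern_prod A p) (- U \<inter> - V)"
proof -
  have "- V - U = - U \<inter> - V" "- V \<inter> U = U - V" by auto
  then have "measure_pmf.prob (bern_prod A p) (- U \<inter> - V)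
      = measure_pmf.prob (bern_prod A p) (- V) - measure_pmf.prob (bern_prod A p) (U - V)"
    using measure_pmf.finite_measure_Diff'[of "- V" "bern_prod A p" U] by simp
  then show ?thesis
    using Harris_mixed[OF assms] by (simp add: prob_Compl[of _ U] algebra_simps)
qed

text \<open>The hypothesis on \<open>D\<close> says that it ignores the coordinates in \<open>F\<close>; this is the
independence that enters Janson's inequality.\<close>

lemma prob_all_on_Int:
  assumes "finite A" "0 \<le> p" "p \<le> 1" "F \<subseteq> A"
    and "\<And>f g. (\<And>e. e \<notin> F \<Longrightarrow> f e = g e) \<Longrightarrow> f \<in> D \<longleftrightarrow> g \<in> D"
  shows "measure_pmf.prob (bern_prod A p) (all_on F \<inter> D)
    = p ^ card F * measure_pmf.prob (bern_prod A p) D"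
  using assms(1,4,5)
proof (induction A arbitrary: F D)
  case empty
  then show ?case by (simp add: all_on_def)
next
  case (insert x A)
  let ?P = "measure_pmf.prob (bern_prod A p)"
  note step = prob_bern_prod_insert[OF insert.hyps(1,2) assms(2,3)]
  define sec where "sec y = {f. f(x := y) \<in> D}" for y
  have sec_cong: "f \<in> sec y \<longleftrightarrow> g \<in> sec y" if "\<And>e. e \<notin> F - {x} \<Longrightarrow> f e = g e" for f g y
    unfolding sec_def mem_Collect_eq by (rule insert.prems) (use that in auto)
  have IH: "?P (all_on (F - {x}) \<inter> sec y) = p ^ card (F - {x}) * ?P (sec y)" for y
  proof (rule insert.IH)
    show "F - {x} \<subseteq> A" using insert.prems(1) by auto
  qed (rule sec_cong)
  show ?case
  proof (cases "x \<in> F")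
    case True
    have "f(x := y) \<in> D \<longleftrightarrow> f \<in> D" for f y
      by (rule insert.prems) (use True in auto)
    then have D: "sec y = D" for y by (auto simp: sec_def)
    have *: "{f. f(x := True) \<in> all_on F \<inter> D} = all_on (F - {x}) \<inter> sec True"
      "{f. f(x := False) \<in> all_on F \<inter> D} = {}"
      using True by (auto simp: all_on_def sec_def)
    have "finite F" using insert.prems(1) insert.hyps(1) finite_subset by blast
    then have "card F = Suc (card (F - {x}))" using True by (metis card_Suc_Diff1)
    moreover have "measure_pmf.prob (bern_prod (insert x A) p) D = ?P D"
      unfolding step[of D] using D by (simp add: sec_def algebra_simps)
    ultimately show ?thesis
      unfolding step[of "all_on F \<inter> D"] * using IH[of True] by (simp add: D)
  next
    case False
    then have *: "{f. f(x := y) \<in> all_on F \<inter> D} = all_on (F - {x}) \<inter> sec y" for y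
      by (auto simp: all_on_def sec_def)
    have **: "{f. f(x := y) \<in> D} = sec y" for y by (simp add: sec_def)
    show ?thesis unfolding step * ** IH using False by (simp add: algebra_simps)
  qed
qed

lemma prob_all_on:
  assumes "finite A" "0 \<le> p" "p \<le> 1" "F \<subseteq> A"
  shows "measure_pmf.prob (bern_prod A p) (all_on F) = p ^ card F"
  using prob_all_on_Int[OF assms, of UNIV] by simp

lemma all_on_Un: "all_on (F \<union> G) = all_on F \<inter> all_on G"
  by (auto simp: all_on_def)

lemma increasing_all_on: "increasing (all_on F)"
  by (auto simp: increasing_def all_on_def le_fun_def)

lemma increasing_UN: "(\<And>i. i \<in> I \<Longrightarrow> increasing (U i)) \<Longrightarrow> increasing (\<Union>i\<in>I. U i)"
  unfolding increasing_def by blast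

text \<open>Iterating Harris's inequality: the lower bound that would be an equality for pairwise disjoint sets \<open>F i\<close>.\<close>

lemma Harris_prod:
  assumes "finite A" "0 \<le> p" "p \<le> 1" "finite I" "\<And>i. i \<in> I \<Longrightarrow> F i \<subseteq> A"
  shows "(\<Prod>i\<in>I. 1 - p ^ card (F i)) \<le> measure_pmf.prob (bern_prod A p) (- (\<Union>i\<in>I. all_on (F i)))"
  using assms(4,5)
proof (induction I)
  case empty
  then show ?case by simp
next
  case (insert i I)
  let ?P = "measure_pmf.prob (bern_prod A p)"
  have "(\<Prod>i\<in>insert i I. 1 - p ^ card (F i)) = ?P (- all_on (F i)) * (\<Prod>i\<in>I. 1 - p ^ card (F i))"
    using insert assms by (simp add: prob_Compl prob_all_on)
  also have "\<dots> \<le> ?P (- all_on (F i)) * ?P (- (\<Union>i\<in>I. all_on (F i)))"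
    using insert by (intro mult_left_mono) auto
  also have "\<dots> \<le> ?P (- all_on (F i) \<inter> - (\<Union>i\<in>I. all_on (F i)))"
    by (intro Harris_decreasing increasing_UN increasing_all_on assms)
  finally show ?case by (simp add: Compl_Un)
qed

text \<open>Janson's inequality, by the argument of Boppana and Spencer. Adding the sets one at a time, it suffices
that a new set \<open>i\<close> multiplies the probability by at most \<open>exp (- c)\<close>, where \<open>c\<close> is \<open>p ^ card (F i)\<close>
reduced by the joint probabilities with the earlier sets that overlap \<open>F i\<close>. The earlier sets disjoint
from \<open>F i\<close> form an event \<open>D\<close> independent of \<open>i\<close>; the overlapping ones are removed by a union bound in
which Harris's inequality discards \<open>D\<close>, since \<open>D\<close> is decreasing and ``\<open>F i\<close> and \<open>F j\<close> are present''
is increasing. The sum runs over ordered pairs and so counts every overlap twice; the usual factor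
\<open>1 / 2\<close> is given away.\<close>

lemma Janson:
  assumes A: "finite A" "0 \<le> p" "p \<le> 1" and "finite I" "\<And>i. i \<in> I \<Longrightarrow> F i \<subseteq> A"
  shows "measure_pmf.prob (bern_prod A p) (- (\<Union>i\<in>I. all_on (F i)))
    \<le> exp (- (\<Sum>i\<in>I. p ^ card (F i))
        + (\<Sum>i\<in>I. \<Sum>j | j \<in> I \<and> j \<noteq> i \<and> F i \<inter> F j \<noteq> {}. p ^ card (F i \<union> F j)))"
  using assms(4,5)
proof (induction I)
  case empty
  then show ?case by simp
next
  case (insert i I)
  let ?P = "measure_pmf.prob (bern_prod A p)"
  let ?B = "\<lambda>j. all_on (F j)"
  define N where "N = {j \<in> I. F i \<inter> F j \<noteq> {}}"
  define c where "c = p ^ card (F i) - (\<Sum>j\<in>N. p ^ card (F i \<union> F j))"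
  define D where "D = - (\<Union>j\<in>I - N. ?B j)"
  define E where "E = - (\<Union>j\<in>I. ?B j)"
  have fin: "finite N" using insert.hyps by (simp add: N_def)
  have ED: "E = D - (\<Union>j\<in>N. ?B j)" by (auto simp: D_def E_def N_def)
  have indep: "?P (?B i \<inter> D) = p ^ card (F i) * ?P D"
  proof (rule prob_all_on_Int[OF A])
    show "F i \<subseteq> A" using insert.prems by auto
    fix f g :: "'a \<Rightarrow> bool" assume eq: "\<And>e. e \<notin> F i \<Longrightarrow> f e = g e"
    have "f \<in> ?B j \<longleftrightarrow> g \<in> ?B j" if "j \<in> I - N" for j
    proof -
      have "e \<notin> F i" if "e \<in> F j" for e using that \<open>j \<in> I - N\<close> by (auto simp: N_def)
      then show ?thesis using eq by (auto simp: all_on_def)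
    qed
    then show "f \<in> D \<longleftrightarrow> g \<in> D" by (auto simp: D_def)
  qed
  have corr: "?P (?B i \<inter> ?B j \<inter> D) \<le> p ^ card (F i \<union> F j) * ?P D" if "j \<in> N" for j
  proof -
    have "?P (all_on (F i \<union> F j) - (\<Union>j\<in>I - N. ?B j)) \<le> ?P (all_on (F i \<union> F j)) * ?P D"
      unfolding D_def by (intro Harris_mixed increasing_UN increasing_all_on A)
    moreover have "F i \<union> F j \<subseteq> A" using that insert.prems by (auto simp: N_def)
    ultimately have "?P (all_on (F i \<union> F j) - (\<Union>j\<in>I - N. ?B j)) \<le> p ^ card (F i \<union> F j) * ?P D"
      using A by (simp add: prob_all_on)
    then show ?thesis by (simp add: all_on_Un D_def Diff_eq)
  qed
  \<comment> \<open>On \<open>?B i \<inter> D\<close>, either no overlapping set is present, which gives \<open>?B i \<inter> E\<close>, or some is.\<close>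
  have "p ^ card (F i) * ?P D = ?P (?B i \<inter> D)" using indep by simp
  also have "\<dots> \<le> ?P (?B i \<inter> E \<union> (\<Union>j\<in>N. ?B i \<inter> ?B j \<inter> D))"
    by (intro measure_pmf.finite_measure_mono) (auto simp: ED)
  also have "\<dots> \<le> ?P (?B i \<inter> E) + ?P (\<Union>j\<in>N. ?B i \<inter> ?B j \<inter> D)"
    by (intro measure_Un_le) auto
  also have "\<dots> \<le> ?P (?B i \<inter> E) + (\<Sum>j\<in>N. ?P (?B i \<inter> ?B j \<inter> D))"
    by (intro add_left_mono measure_UNION_le fin) auto
  also have "\<dots> \<le> ?P (?B i \<inter> E) + (\<Sum>j\<in>N. p ^ card (F i \<union> F j) * ?P D)"
    by (intro add_left_mono sum_mono corr)
  finally have "c * ?P D \<le> ?P (?B i \<inter> E)"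
    by (simp add: c_def algebra_simps sum_distrib_left sum_distrib_right)
  moreover have "- (\<Union>j\<in>insert i I. ?B j) = E - ?B i" by (auto simp: E_def)
  then have "?P (- (\<Union>j\<in>insert i I. ?B j)) = ?P E - ?P (?B i \<inter> E)"
    using measure_pmf.finite_measure_Diff'[of E "bern_prod A p" "?B i"] by (simp add: Int_commute)
  ultimately have 1: "?P (- (\<Union>j\<in>insert i I. ?B j)) \<le> ?P E - c * ?P D" by simp
  \<comment> \<open>A negative \<open>c\<close> makes the estimate weaker than monotonicity, so both signs are covered.\<close>
  have "?P (- (\<Union>j\<in>insert i I. ?B j)) \<le> ?P E * exp (- c)"
  proof (cases "c \<ge> 0")
    case True
    have "?P E \<le> ?P D" by (intro measure_pmf.finite_measure_mono) (auto simp: ED)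
    then have "?P E - c * ?P D \<le> ?P E * (1 - c)"
      using True by (simp add: algebra_simps mult_left_mono)
    also have "\<dots> \<le> ?P E * exp (- c)"
      using exp_ge_add_one_self[of "- c"] by (intro mult_left_mono) auto
    finally show ?thesis using 1 by linarith
  next
    case False
    have "?P (- (\<Union>j\<in>insert i I. ?B j)) \<le> ?P E * 1"
      unfolding E_def by (simp, intro measure_pmf.finite_measure_mono) auto
    also have "\<dots> \<le> ?P E * exp (- c)" using False by (intro mult_left_mono) auto
    finally show ?thesis .
  qed
  also have "\<dots> \<le> exp (- (\<Sum>i\<in>I. p ^ card (F i))
        + (\<Sum>i\<in>I. \<Sum>j | j \<in> I \<and> j \<noteq> i \<and> F i \<inter> F j \<noteq> {}. p ^ card (F i \<union> F j))) * exp (- c)"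
    using insert.IH insert.prems by (intro mult_right_mono) (auto simp: E_def)
  also have "\<dots> \<le> exp (- (\<Sum>k\<in>insert i I. p ^ card (F k))
        + (\<Sum>k\<in>insert i I. \<Sum>j | j \<in> insert i I \<and> j \<noteq> k \<and> F k \<inter> F j \<noteq> {}. p ^ card (F k \<union> F j)))"
  proof -
    have "{j. j \<in> insert i I \<and> j \<noteq> i \<and> F i \<inter> F j \<noteq> {}} = N"
      using insert.hyps by (auto simp: N_def)
    moreover have "(\<Sum>k\<in>I. \<Sum>j | j \<in> I \<and> j \<noteq> k \<and> F k \<inter> F j \<noteq> {}. p ^ card (F k \<union> F j))
      \<le> (\<Sum>k\<in>I. \<Sum>j | j \<in> insert i I \<and> j \<noteq> k \<and> F k \<inter> F j \<noteq> {}. p ^ card (F k \<union> F j))"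
      using insert.hyps A by (intro sum_mono sum_mono2) auto
    ultimately show ?thesis
      using insert.hyps by (simp add: exp_add[symmetric] c_def)
  qed
  finally show ?case .
qed

section \<open>Counting cliques and the tail of the number of uncovered vertices\<close>

text \<open>Iterated Pascal rule. Bounding the summands from both sides gives the two estimates that follow.\<close>

lemma binomial_add_eq_sum:
  "(m + d) choose Suc k = (m choose Suc k) + (\<Sum>i<d. (m + i) choose k)"
  by (induction d) auto

lemma binomial_diff_le:
  assumes "0 < k" "t \<le> m"
  shows "(m choose k) \<le> ((m - t) choose k) + t * ((m - 1) choose (k - 1))"
proof -
  obtain k' where k: "k = Suc k'" using assms by (cases k) auto
  have "(\<Sum>i<t. (m - t + i) choose k') \<le> (\<Sum>i<t. (m - 1) choose k')"
    using assms by (intro sum_mono binomial_right_mono) auto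
  then show ?thesis using binomial_add_eq_sum[of "m - t" t k'] assms by (simp add: k)
qed

lemma binomial_diff_ge:
  assumes "0 < k" "t \<le> m"
  shows "((m - t) choose k) + t * ((m - t) choose (k - 1)) \<le> (m choose k)"
proof -
  obtain k' where k: "k = Suc k'" using assms by (cases k) auto
  have "(\<Sum>i<t. (m - t) choose k') \<le> (\<Sum>i<t. (m - t + i) choose k')"
    using assms by (intro sum_mono binomial_right_mono) auto
  then show ?thesis using binomial_add_eq_sum[of "m - t" t k'] assms by (simp add: k)
qed

text \<open>Replacing \<open>n - 1\<close> by \<open>n - t\<close> loses a negligible proportion when \<open>t = o(n)\<close>: the loss is at most
\<open>(t - 1) * ((n - 2) choose (k - 1))\<close>, and the second factor is \<open>k / (n - 1)\<close> times
\<open>(n - 1) choose k\<close>. Finally \<open>(t - 1) / (n - 1) \<le> t / n\<close>.\<close>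

lemma binomial_ratio_lower:
  assumes "0 < k" "1 \<le> t" "t \<le> n"
  shows "real ((n - 1) choose k) * (1 - real k * real t / real n) \<le> real ((n - t) choose k)"
proof (cases "n = 1")
  case True
  then show ?thesis using assms by (simp add: binomial_eq_0)
next
  case False
  let ?N = "real ((n - 1) choose k)"
  have n: "n \<ge> 2" using False assms by auto
  have "real ((n - 1) choose k) \<le> real ((n - t) choose k) + real (t - 1) * real ((n - 2) choose (k - 1))"
  proof -
    have "n - 1 - (t - 1) = n - t" "n - 1 - 1 = n - 2" using assms by auto
    then show ?thesis
      using binomial_diff_le[of k "t - 1" "n - 1"] assms
      by (metis (no_types) diff_le_mono of_nat_add of_nat_le_iff of_nat_mult)
  qed
  moreover have "real ((n - 2) choose (k - 1)) = real k * ?N / real (n - 1)"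
  proof -
    have "k * ((n - 1) choose k) = (n - 1) * ((n - 2) choose (k - 1))"
      using times_binomial_minus1_eq[of k "n - 1"] assms by (simp add: numeral_2_eq_2)
    then have "real k * ?N = real (n - 1) * real ((n - 2) choose (k - 1))"
      by (metis of_nat_mult)
    then show ?thesis using n by (simp add: field_simps)
  qed
  ultimately have "?N \<le> real ((n - t) choose k) + real (t - 1) / real (n - 1) * (real k * ?N)"
    by simp
  also have "\<dots> \<le> real ((n - t) choose k) + real t / real n * (real k * ?N)"
    using assms n by (intro add_left_mono mult_right_mono) (auto simp: field_simps of_nat_diff)
  finally show ?thesis by (simp add: algebra_simps)
qed

definition hitting_sets :: "nat \<Rightarrow> nat \<Rightarrow> nat set \<Rightarrow> nat set set" where
  "hitting_sets n r T = {S \<in> nsets {1..n} r. S \<inter> T \<noteq> {}}"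

lemma finite_hitting_sets [simp]: "finite (hitting_sets n r T)"
  unfolding hitting_sets_def by (simp add: finite_imp_finite_nsets)

lemma card_hitting_sets:
  assumes "T \<subseteq> {1..n}"
  shows "card (hitting_sets n r T) + ((n - card T) choose r) = n choose r"
proof -
  have fin: "finite T" using assms finite_subset by blast
  have "hitting_sets n r T \<union> nsets ({1..n} - T) r = nsets {1..n} r"
    by (auto simp: hitting_sets_def nsets_def)
  moreover have "hitting_sets n r T \<inter> nsets ({1..n} - T) r = {}"
    by (auto simp: hitting_sets_def nsets_def)
  moreover have "card (nsets ({1..n} - T) r) = (n - card T) choose r"
    using assms fin by (simp add: card_nsets card_Diff_subset)
  ultimately show ?thesis
    using card_Un_disjoint[of "hitting_sets n r T" "nsets ({1..n} - T) r"]
    by (simp add: finite_imp_finite_nsets)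
qed

text \<open>An upper bound for the mean number of further cliques sharing between \<open>2\<close> and \<open>r - 1\<close> vertices with
a given clique, conditionally on the latter being present: \<open>j\<close> is the number of shared vertices, and
the \<open>j choose 2\<close> pairs among them are already edges.\<close>

definition overlap_weight :: "nat \<Rightarrow> nat \<Rightarrow> real \<Rightarrow> real" where
  "overlap_weight r n p =
    (\<Sum>j = 2..<r. real (r choose j) * real n ^ (r - j) * p ^ ((r choose 2) - (j choose 2)))"

text \<open>Such a set is determined by the \<open>j\<close> vertices it shares with \<open>S\<close> and the \<open>r - j\<close> outside \<open>S\<close>.\<close>

lemma card_overlapping_sets:
  assumes "S \<in> nsets {1..n} r" "j \<le> r"
  shows "card {S' \<in> nsets {1..n} r. card (S \<inter> S') = j} \<le> (r choose j) * n ^ (r - j)"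
proof -
  let ?X = "{S' \<in> nsets {1..n} r. card (S \<inter> S') = j}"
  have S: "finite S" "card S = r" using assms by (auto simp: nsets_def)
  have "card ?X \<le> card (nsets S j \<times> nsets {1..n} (r - j))"
  proof (rule card_inj_on_le)
    show "inj_on (\<lambda>S'. (S \<inter> S', S' - S)) ?X" by (auto simp: inj_on_def)
    show "(\<lambda>S'. (S \<inter> S', S' - S)) ` ?X \<subseteq> nsets S j \<times> nsets {1..n} (r - j)"
      using S by (auto simp: nsets_def card_Diff_subset_Int Int_commute)
    show "finite (nsets S j \<times> nsets {1..n} (r - j))"
      using S by (simp add: finite_imp_finite_nsets)
  qed
  also have "\<dots> = (r choose j) * (n choose (r - j))"
    using S by (simp add: card_cartesian_product card_nsets)
  also have "\<dots> \<le> (r choose j) * n ^ (r - j)"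
    by (cases "r - j \<le> n") (auto intro: binomial_le_pow simp: binomial_eq_0)
  finally show ?thesis .
qed

text \<open>The correction term of Janson's inequality at a fixed \<open>S\<close>. Two distinct \<open>r\<close>-sets that share an
edge have between \<open>2\<close> and \<open>r - 1\<close> common vertices, and grouping by their number \<open>j\<close> makes every
summand depend on \<open>j\<close> only.\<close>

lemma sum_overlap_le:
  assumes S: "S \<in> nsets {1..n} r" and p: "0 \<le> p" "p \<le> 1" and I: "I \<subseteq> nsets {1..n} r"
  shows "(\<Sum>S' | S' \<in> I \<and> S' \<noteq> S \<and> nsets S 2 \<inter> nsets S' 2 \<noteq> {}. p ^ card (nsets S 2 \<union> nsets S' 2))
    \<le> p ^ (r choose 2) * overlap_weight r n p"
proof -
  let ?X = "{S'. S' \<in> I \<and> S' \<noteq> S \<and> nsets S 2 \<inter> nsets S' 2 \<noteq> {}}"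
  let ?w = "\<lambda>S'. p ^ card (nsets S 2 \<union> nsets S' 2)"
  have finI: "finite I" using I finite_subset by (blast intro: finite_imp_finite_nsets)
  have fS: "finite S" "card S = r" using S by (auto simp: nsets_def)
  have inter: "nsets S 2 \<inter> nsets S' 2 = nsets (S \<inter> S') 2" for S' :: "nat set"
    by (auto simp: nsets_def)
  have range: "card (S \<inter> S') \<in> {2..<r}" if "S' \<in> ?X" for S'
  proof -
    have fS': "finite S'" "card S' = r" using that I by (auto simp: nsets_def)
    have "nsets (S \<inter> S') 2 \<noteq> {}" using that inter by auto
    then obtain e where "e \<subseteq> S \<inter> S'" "card e = 2" by (auto simp: nsets_def)
    then have "card (S \<inter> S') \<ge> 2" using fS by (metis card_mono finite_Int)
    moreover have "card (S \<inter> S') \<noteq> r"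
    proof
      assume "card (S \<inter> S') = r"
      then have "S \<inter> S' = S" "S \<inter> S' = S'"
        using card_subset_eq[of S "S \<inter> S'"] card_subset_eq[of S' "S \<inter> S'"] fS fS' by auto
      then show False using that by auto
    qed
    moreover have "card (S \<inter> S') \<le> r" using fS by (metis card_mono inf_le1)
    ultimately show ?thesis by auto
  qed
  have weight: "?w S' = p ^ (r choose 2) * p ^ ((r choose 2) - (j choose 2))"
    if "S' \<in> ?X" "card (S \<inter> S') = j" for S' j
  proof -
    have fS': "finite S'" "card S' = r" using that I by (auto simp: nsets_def)
    have "card (nsets S 2 \<union> nsets S' 2) + (j choose 2) = (r choose 2) + (r choose 2)"
      using card_Un_Int[of "nsets S 2" "nsets S' 2"] fS fS' that
      by (simp add: inter card_nsets finite_imp_finite_nsets)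
    moreover have "j choose 2 \<le> r choose 2" using range[OF that(1)] that(2) by (intro binomial_right_mono) auto
    ultimately have "card (nsets S 2 \<union> nsets S' 2) = (r choose 2) + ((r choose 2) - (j choose 2))" by auto
    then show ?thesis by (simp add: power_add)
  qed
  have "sum ?w ?X = (\<Sum>j = 2..<r. sum ?w {S' \<in> ?X. card (S \<inter> S') = j})"
  proof (rule sum.group[symmetric])
    show "finite ?X" using finI by simp
    show "(\<lambda>S'. card (S \<inter> S')) ` ?X \<subseteq> {2..<r}" using range by blast
  qed simp
  also have "\<dots> \<le> (\<Sum>j = 2..<r. p ^ (r choose 2) *
      (real (r choose j) * real n ^ (r - j) * p ^ ((r choose 2) - (j choose 2))))"
  proof (rule sum_mono)
    fix j assume j: "j \<in> {2..<r}"
    have "sum ?w {S' \<in> ?X. card (S \<inter> S') = j}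
        = real (card {S' \<in> ?X. card (S \<inter> S') = j}) * (p ^ (r choose 2) * p ^ ((r choose 2) - (j choose 2)))"
      using weight by simp
    also have "\<dots> \<le> real ((r choose j) * n ^ (r - j)) * (p ^ (r choose 2) * p ^ ((r choose 2) - (j choose 2)))"
    proof (intro mult_right_mono)
      have "card {S' \<in> ?X. card (S \<inter> S') = j} \<le> card {S' \<in> nsets {1..n} r. card (S \<inter> S') = j}"
        using I by (intro card_mono) (auto simp: finite_imp_finite_nsets)
      also have "\<dots> \<le> (r choose j) * n ^ (r - j)" using card_overlapping_sets[OF S] j by auto
      finally show "real (card {S' \<in> ?X. card (S \<inter> S') = j}) \<le> real ((r choose j) * n ^ (r - j))"
        by (simp only: of_nat_le_iff)
    qed (use p in auto)
    finally show "sum ?w {S' \<in> ?X. card (S \<inter> S') = j} \<le> p ^ (r choose 2) *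
      (real (r choose j) * real n ^ (r - j) * p ^ ((r choose 2) - (j choose 2)))"
      by (simp add: mult_ac)
  qed
  finally show ?thesis by (simp add: overlap_weight_def sum_distrib_left)
qed

definition all_uncovered :: "nat \<Rightarrow> nat \<Rightarrow> nat set \<Rightarrow> nat set set set" where
  "all_uncovered r n T = {E. \<forall>S \<in> Kr_copies r n E. S \<inter> T = {}}"

lemma prob_all_uncovered:
  "measure_pmf.prob (gnp n p) (all_uncovered r n T) =
    measure_pmf.prob (bern_prod (nsets {1..n} 2) p) (- (\<Union>S\<in>hitting_sets n r T. all_on (nsets S 2)))"
proof -
  have "(\<lambda>f. {e \<in> nsets {1..n} 2. f e}) -` all_uncovered r n T
      = - (\<Union>S\<in>hitting_sets n r T. all_on (nsets S 2))"
  proof -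
    have copy: "nsets S 2 \<subseteq> {e \<in> nsets {1..n} 2. f e} \<longleftrightarrow> f \<in> all_on (nsets S 2)"
      if "S \<in> nsets {1..n} r" for S f
    proof -
      have "nsets S 2 \<subseteq> nsets {1..n} 2"
        using that by (intro nsets_mono) (simp add: nsets_def)
      then show ?thesis unfolding all_on_def by blast
    qed
    have "{e \<in> nsets {1..n} 2. f e} \<in> all_uncovered r n T \<longleftrightarrow>
        (\<forall>S \<in> hitting_sets n r T. f \<notin> all_on (nsets S 2))" for f
      unfolding all_uncovered_def hitting_sets_def Kr_copies_def mem_Collect_eq Ball_def
      using copy by blast
    then show ?thesis by (intro set_eqI) (simp only: vimage_eq Compl_iff UN_iff bex_simps ball_simps; blast)
  qed
  then show ?thesis by (simp add: gnp_def)
qed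

lemma card_edges:
  assumes "S \<in> hitting_sets n r T"
  shows "card (nsets S 2) = r choose 2" "nsets S 2 \<subseteq> nsets {1..n} 2"
  using assms by (auto simp: hitting_sets_def nsets_def card_nsets[unfolded nsets_def])

text \<open>Harris's inequality for the \<open>r\<close>-sets meeting \<open>T\<close>, each of which has \<open>r choose 2\<close> pairs.\<close>

lemma prob_all_uncovered_ge:
  assumes "0 \<le> p" "p \<le> 1"
  shows "(1 - p ^ (r choose 2)) ^ card (hitting_sets n r T)
    \<le> measure_pmf.prob (gnp n p) (all_uncovered r n T)"
proof -
  have "(\<Prod>S\<in>hitting_sets n r T. 1 - p ^ card (nsets S 2))
    \<le> measure_pmf.prob (gnp n p) (all_uncovered r n T)"
    unfolding prob_all_uncovered
    by (rule Harris_prod) (use assms card_edges in \<open>auto simp: finite_imp_finite_nsets\<close>)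
  then show ?thesis by (simp add: card_edges del: card_nsets)
qed

lemma prob_all_uncovered_le:
  assumes "0 \<le> p" "p \<le> 1"
  shows "measure_pmf.prob (gnp n p) (all_uncovered r n T)
    \<le> exp (- (1 - overlap_weight r n p) * (real (card (hitting_sets n r T)) * p ^ (r choose 2)))"
proof -
  let ?I = "hitting_sets n r T"
  have "measure_pmf.prob (gnp n p) (all_uncovered r n T)
    \<le> exp (- (\<Sum>S\<in>?I. p ^ card (nsets S 2))
        + (\<Sum>S\<in>?I. \<Sum>S' | S' \<in> ?I \<and> S' \<noteq> S \<and> nsets S 2 \<inter> nsets S' 2 \<noteq> {}.
            p ^ card (nsets S 2 \<union> nsets S' 2)))"
    unfolding prob_all_uncovered
    by (rule Janson) (use assms card_edges in \<open>auto simp: finite_imp_finite_nsets\<close>)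
  also have "\<dots> \<le> exp (- (\<Sum>S\<in>?I. p ^ (r choose 2)) + (\<Sum>S\<in>?I. p ^ (r choose 2) * overlap_weight r n p))"
    unfolding exp_le_cancel_iff
  proof (intro add_mono sum_mono sum_overlap_le assms)
    show "- (\<Sum>S\<in>?I. p ^ card (nsets S 2)) \<le> - (\<Sum>S\<in>?I. p ^ (r choose 2))"
      by (simp add: card_edges del: card_nsets)
  qed (auto simp: hitting_sets_def)
  finally show ?thesis by (simp add: algebra_simps)
qed

lemma uncovered_ge_iff:
  "uncovered r n E \<ge> t \<longleftrightarrow> (\<exists>T \<in> nsets {1..n} t. E \<in> all_uncovered r n T)"
proof
  let ?U = "{v \<in> {1..n}. \<not> (\<exists>S \<in> Kr_copies r n E. v \<in> S)}"
  {
    assume "uncovered r n E \<ge> t"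
    then obtain T where "T \<subseteq> ?U" "card T = t"
      unfolding uncovered_def by (meson obtain_subset_with_card_n)
    moreover from this have "finite T"
      by (metis (no_types, lifting) finite_atLeastAtMost finite_subset mem_Collect_eq subsetI)
    ultimately show "\<exists>T \<in> nsets {1..n} t. E \<in> all_uncovered r n T"
      by (intro bexI[of _ T]) (auto simp: nsets_def all_uncovered_def)
  next
    assume "\<exists>T \<in> nsets {1..n} t. E \<in> all_uncovered r n T"
    then obtain T where T: "T \<in> nsets {1..n} t" "E \<in> all_uncovered r n T" by blast
    then have "card T \<le> card ?U" by (intro card_mono) (auto simp: nsets_def all_uncovered_def)
    then show "uncovered r n E \<ge> t" using T by (simp add: uncovered_def nsets_def)
  }
qed

text \<open>The set \<open>{1..t}\<close> alone already gives this much. The factor \<open>1 + 2 * q\<close> is the price of passing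
from \<open>1 - q\<close> to an exponential, by \<open>ln (1 - q) \<ge> - q - 2 * q\<^sup>2\<close>.\<close>

lemma prob_uncovered_ge_lower:
  assumes p: "0 \<le> p" "p \<le> 1" and q: "p ^ (r choose 2) \<le> 1 / 2" and "0 < r" "t \<le> n"
  shows "exp (- ((1 + 2 * p ^ (r choose 2)) * (real t * (real ((n - 1) choose (r - 1)) * p ^ (r choose 2)))))
    \<le> measure_pmf.prob (gnp n p) {E. uncovered r n E \<ge> t}"
proof -
  let ?q = "p ^ (r choose 2)"
  let ?h = "card (hitting_sets n r {1..t})"
  have q0: "0 \<le> ?q" using p by simp
  have "?h + ((n - t) choose r) = n choose r"
    using card_hitting_sets[of "{1..t}" n r] assms by simp
  then have "?h \<le> t * ((n - 1) choose (r - 1))"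
    using binomial_diff_le[of r t n] assms by linarith
  then have h: "real ?h \<le> real t * real ((n - 1) choose (r - 1))"
    by (metis of_nat_le_iff of_nat_mult)
  have "- ?q - 2 * ?q\<^sup>2 \<le> ln (1 - ?q)" by (intro ln_one_minus_pos_lower_bound q q0)
  then have "real ?h * (- ((1 + 2 * ?q) * ?q)) \<le> real ?h * ln (1 - ?q)"
    by (intro mult_left_mono) (auto simp: algebra_simps power2_eq_square)
  also have "\<dots> = ln ((1 - ?q) ^ ?h)" using q by (simp add: ln_realpow)
  finally have 1: "- (real ?h * ((1 + 2 * ?q) * ?q)) \<le> ln ((1 - ?q) ^ ?h)" by simp
  have "real ?h * ((1 + 2 * ?q) * ?q) \<le> real t * real ((n - 1) choose (r - 1)) * ((1 + 2 * ?q) * ?q)"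
    using q0 by (intro mult_right_mono h) auto
  with 1 have "- ((1 + 2 * ?q) * (real t * (real ((n - 1) choose (r - 1)) * ?q))) \<le> ln ((1 - ?q) ^ ?h)"
    by (simp add: mult_ac)
  then have "exp (- ((1 + 2 * ?q) * (real t * (real ((n - 1) choose (r - 1)) * ?q)))) \<le> exp (ln ((1 - ?q) ^ ?h))"
    by (simp only: exp_le_cancel_iff)
  also have "\<dots> = (1 - ?q) ^ ?h" using q by (intro exp_ln) auto
  also have "\<dots> \<le> measure_pmf.prob (gnp n p) (all_uncovered r n {1..t})"
    by (rule prob_all_uncovered_ge[OF p])
  also have "\<dots> \<le> measure_pmf.prob (gnp n p) {E. uncovered r n E \<ge> t}"
    using assms by (intro measure_pmf.finite_measure_mono)
      (auto simp: uncovered_ge_iff nsets_def intro!: exI[of _ "{1..t}"])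
  finally show ?thesis .
qed

text \<open>Union bound over all \<open>t\<close>-sets \<open>T\<close>, with Janson's inequality for each and
\<open>n choose t \<le> n ^ t\<close>.\<close>

lemma prob_uncovered_ge_upper:
  assumes p: "0 \<le> p" "p \<le> 1" and w: "overlap_weight r n p \<le> 1" and "1 < r" "1 \<le> t" "t \<le> n"
  shows "measure_pmf.prob (gnp n p) {E. uncovered r n E \<ge> t}
    \<le> exp (real t * ln (real n) - (1 - overlap_weight r n p) * ((1 - real (r - 1) * real t / real n)
        * (real t * (real ((n - 1) choose (r - 1)) * p ^ (r choose 2)))))"
proof -
  let ?q = "p ^ (r choose 2)" and ?w = "overlap_weight r n p"
  let ?N = "real ((n - 1) choose (r - 1))" and ?b = "1 - real (r - 1) * real t / real n"
  have each: "measure_pmf.prob (gnp n p) (all_uncovered r n T) \<le> exp (- (1 - ?w) * (?b * (real t * (?N * ?q))))"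
    if "T \<in> nsets {1..n} t" for T
  proof -
    have T: "T \<subseteq> {1..n}" "card T = t" using that by (auto simp: nsets_def)
    have "t * ((n - t) choose (r - 1)) \<le> card (hitting_sets n r T)"
      using card_hitting_sets[OF T(1), of r] binomial_diff_ge[of r t n] assms(4,6) unfolding T(2)
      by linarith
    then have "real t * real ((n - t) choose (r - 1)) \<le> real (card (hitting_sets n r T))"
      by (metis of_nat_le_iff of_nat_mult)
    moreover have "real t * (?N * ?b) \<le> real t * real ((n - t) choose (r - 1))"
      using assms by (intro mult_left_mono binomial_ratio_lower) auto
    ultimately have "real t * (?N * ?b) \<le> real (card (hitting_sets n r T))" by linarith
    then have "(1 - ?w) * (real t * (?N * ?b) * ?q) \<le> (1 - ?w) * (real (card (hitting_sets n r T)) * ?q)"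
      using w p by (intro mult_left_mono mult_right_mono) auto
    then have "exp (- (1 - ?w) * (real (card (hitting_sets n r T)) * ?q)) \<le> exp (- (1 - ?w) * (?b * (real t * (?N * ?q))))"
      unfolding exp_le_cancel_iff mult_minus_left neg_le_iff_le by (simp only: mult_ac)
    then show ?thesis using prob_all_uncovered_le[OF p, of n r T] by linarith
  qed
  have "measure_pmf.prob (gnp n p) {E. uncovered r n E \<ge> t}
      = measure_pmf.prob (gnp n p) (\<Union>T\<in>nsets {1..n} t. all_uncovered r n T)"
    by (rule arg_cong[where f = "measure_pmf.prob _"]) (auto simp: uncovered_ge_iff)
  also have "\<dots> \<le> (\<Sum>T\<in>nsets {1..n} t. measure_pmf.prob (gnp n p) (all_uncovered r n T))"
    by (intro measure_UNION_le) (auto simp: finite_imp_finite_nsets)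
  also have "\<dots> \<le> (\<Sum>T\<in>nsets {1..n} t. exp (- (1 - ?w) * (?b * (real t * (?N * ?q)))))"
    by (intro sum_mono each)
  also have "\<dots> = real (n choose t) * exp (- (1 - ?w) * (?b * (real t * (?N * ?q))))"
    by (simp add: card_nsets)
  also have "\<dots> \<le> real n ^ t * exp (- (1 - ?w) * (?b * (real t * (?N * ?q))))"
  proof -
    have "real (n choose t) \<le> real n ^ t"
      using binomial_le_pow[of t n] assms by (metis of_nat_le_iff of_nat_power)
    then show ?thesis by (intro mult_right_mono) auto
  qed
  also have "real n ^ t = exp (real t * ln (real n))"
    using assms by (simp add: exp_of_nat_mult)
  finally show ?thesis by (simp only: exp_add[symmetric] mult_minus_left diff_conv_add_uminus)
qed

text \<open>A family of \<open>(n - s) div r\<close> disjoint cliques covers \<open>n - s\<close> vertices and leaves only \<open>s\<close> to be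
uncovered.\<close>

lemma num_factors_eq_0:
  assumes "uncovered r n E > s" "s \<le> n" "r dvd n - s"
  shows "num_factors r s n E = 0"
proof -
  have False if M: "M \<subseteq> Kr_copies r n E" "disjoint M" "card M = (n - s) div r" for M
  proof -
    have S: "S \<subseteq> {1..n}" "finite S" "card S = r" if "S \<in> M" for S
      using that M(1) by (auto simp: Kr_copies_def nsets_def)
    have "card (\<Union>M) = n - s"
      using card_Union_disjoint[of M] M S assms by simp
    moreover have "card (\<Union>M) + uncovered r n E
        = card (\<Union>M \<union> {v \<in> {1..n}. \<not> (\<exists>S \<in> Kr_copies r n E. v \<in> S)})"
      unfolding uncovered_def
    proof (rule card_Un_disjoint[symmetric])
      show "finite (\<Union>M)" using S by (meson Sup_le_iff finite_atLeastAtMost finite_subset)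
    qed (use M in auto)
    moreover have "\<dots> \<le> card {1..n}" using S by (intro card_mono) auto
    ultimately show False using assms by simp
  qed
  then show ?thesis unfolding num_factors_def by (metis (mono_tags, lifting) Collect_empty_eq card.empty)
qed

section \<open>Asymptotics in the given range of \<open>p\<close>\<close>

lemma two_choose_two: "2 * real (r choose 2) = real r * (real r - 1)"
proof -
  have "even (r * (r - 1))" by (cases r) auto
  then have "2 * (r choose 2) = r * (r - 1)" by (simp only: choose_two dvd_mult_div_cancel)
  then have "real (2 * (r choose 2)) = real (r * (r - 1))" by simp
  then show ?thesis by (cases r) (simp_all add: algebra_simps)
qed

text \<open>Because \<open>(r choose 2) - (j choose 2) = (r - j) * (r + j - 1) / 2\<close> and \<open>r + j - 1 \<ge> r + 1\<close> for
\<open>j \<ge> 2\<close>. This is where \<open>n powr (- 2 / (r + 1))\<close> appears as the threshold.\<close>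

lemma power_choose_diff_le:
  fixes p :: real
  assumes p: "0 \<le> p" "p \<le> 1" and j: "2 \<le> j" "j < r"
  shows "p ^ ((r choose 2) - (j choose 2)) \<le> (p powr ((real r + 1) / 2)) ^ (r - j)"
proof -
  let ?m = "(r choose 2) - (j choose 2)"
  obtain d where d: "r = j + d" "d > 0" using j less_imp_add_positive by blast
  have "j choose 2 \<le> r choose 2" using j by (intro binomial_right_mono) auto
  then have "2 * real ?m = real r * (real r - 1) - real j * (real j - 1)"
    using two_choose_two[of r] two_choose_two[of j] by (simp add: of_nat_diff)
  also have "\<dots> = real d * (2 * real j + real d - 1)" by (simp add: d algebra_simps)
  also have "\<dots> \<ge> real d * (real r + 1)"
    using j d by (intro mult_left_mono) auto
  finally have m: "(real r + 1) / 2 * real d \<le> real ?m" by (simp add: mult_ac)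
  show ?thesis
  proof (cases "p = 0")
    case True
    have "0 < (real r + 1) / 2 * real d" using d by simp
    then have "?m > 0" using m by linarith
    then show ?thesis using True by (simp add: zero_power[OF \<open>?m > 0\<close>])
  next
    case False
    then have "p ^ ?m = p powr real ?m" using p by (simp add: powr_realpow)
    also have "\<dots> \<le> p powr ((real r + 1) / 2 * real d)" using m p by (intro powr_mono') auto
    also have "\<dots> = (p powr ((real r + 1) / 2)) powr real d" by (rule powr_powr[symmetric])
    also have "\<dots> = (p powr ((real r + 1) / 2)) ^ d"
      using False by (intro powr_realpow) simp
    finally show ?thesis by (simp add: d)
  qed
qed

text \<open>Up to a binomial factor, the summand for \<open>j\<close> is at most the \<open>(r - j)\<close>-th power of
\<open>n * p powr ((r + 1) / 2)\<close>, which tends to \<open>0\<close> by the upper bound on \<open>p\<close>.\<close>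

lemma overlap_weight_tendsto_0:
  assumes p: "\<And>n. 0 \<le> p n \<and> p n \<le> 1"
    and small: "p \<in> o(\<lambda>n. real n powr (- 2 / (real r + 1)))"
  shows "(\<lambda>n. overlap_weight r n (p n)) \<longlonglongrightarrow> 0"
proof -
  define x where "x n = real n * p n powr ((real r + 1) / 2)" for n
  have "(\<lambda>n. (p n / real n powr (- 2 / (real r + 1))) powr ((real r + 1) / 2)) \<longlonglongrightarrow> 0"
    using p by (intro tendsto_zero_powrI[OF smalloD_tendsto[OF small] tendsto_const]) auto
  moreover have "\<forall>\<^sub>F n in sequentially.
      (p n / real n powr (- 2 / (real r + 1))) powr ((real r + 1) / 2) = x n"
    using eventually_gt_at_top[of 0]
  proof eventually_elim
    case (elim n)
    have "(real n powr (- 2 / (real r + 1))) powr ((real r + 1) / 2) = real n powr (- 1)"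
    proof -
      have "- 2 / (real r + 1) * ((real r + 1) / 2) = - 1"
        by (simp add: field_simps add_pos_pos)
      then show ?thesis by (simp only: powr_powr)
    qed
    then have "(p n / real n powr (- 2 / (real r + 1))) powr ((real r + 1) / 2)
        = p n powr ((real r + 1) / 2) / real n powr (- 1)"
      using p[of n] by (simp only: powr_divide powr_ge_zero)
    also have "\<dots> = x n" using elim by (simp add: x_def powr_minus_divide)
    finally show ?case .
  qed
  ultimately have x: "x \<longlonglongrightarrow> 0" by (rule Lim_transform_eventually)
  have "(\<lambda>n. real (r choose j) * real n ^ (r - j) * p n ^ ((r choose 2) - (j choose 2))) \<longlonglongrightarrow> 0"
    if j: "j \<in> {2..<r}" for j
  proof (rule tendsto_sandwich)
    show "(\<lambda>_. 0) \<longlonglongrightarrow> (0 :: real)" by simp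
    show "(\<lambda>n. real (r choose j) * x n ^ (r - j)) \<longlonglongrightarrow> 0"
      using j by (intro tendsto_mult_right_zero tendsto_null_power x) auto
    show "\<forall>\<^sub>F n in sequentially. 0 \<le> real (r choose j) * real n ^ (r - j) * p n ^ ((r choose 2) - (j choose 2))"
      using p by simp
    show "\<forall>\<^sub>F n in sequentially. real (r choose j) * real n ^ (r - j) * p n ^ ((r choose 2) - (j choose 2))
        \<le> real (r choose j) * x n ^ (r - j)"
    proof (rule always_eventually, rule allI)
      fix n
      have "p n ^ ((r choose 2) - (j choose 2)) \<le> (p n powr ((real r + 1) / 2)) ^ (r - j)"
        using p j by (intro power_choose_diff_le) auto
      then have "real (r choose j) * real n ^ (r - j) * p n ^ ((r choose 2) - (j choose 2))
          \<le> real (r choose j) * real n ^ (r - j) * (p n powr ((real r + 1) / 2)) ^ (r - j)"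
        by (intro mult_left_mono) auto
      then show "real (r choose j) * real n ^ (r - j) * p n ^ ((r choose 2) - (j choose 2))
          \<le> real (r choose j) * x n ^ (r - j)"
        by (simp add: x_def power_mult_distrib mult_ac)
    qed
  qed
  then show ?thesis unfolding overlap_weight_def by (intro tendsto_null_sum)
qed

definition vertex_mean :: "nat \<Rightarrow> nat \<Rightarrow> real \<Rightarrow> real" where
  "vertex_mean r n p = real ((n - 1) choose (r - 1)) * p ^ (r choose 2)"

text \<open>The \<open>(r choose 2)\<close>-th power of the lower bound on \<open>p\<close> reads
\<open>n powr (- (r - 1)) * ln n = o(p ^ (r choose 2))\<close>, and \<open>(n - 1) choose (r - 1)\<close> is of order
\<open>n ^ (r - 1)\<close>.\<close>

lemma ln_over_vertex_mean_tendsto_0: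
  assumes r: "2 \<le> r" and p: "\<And>n. 0 \<le> p n"
    and large: "(\<lambda>n. real n powr (- 2 / real r) * ln (real n) powr (1 / real (r choose 2))) \<in> o(p)"
  shows "(\<lambda>n. ln (real n) / vertex_mean r n (p n)) \<longlonglongrightarrow> 0"
proof -
  let ?K = "r choose 2"
  define k where "k = r - 1"
  have k: "k > 0" "real k = real r - 1" using r by (auto simp: k_def)
  have K: "?K > 0" using r by simp
  define x where "x n = (real n powr (- 2 / real r) * ln (real n) powr (1 / real ?K) / p n) ^ ?K" for n
  have "x \<longlonglongrightarrow> 0"
    unfolding x_def by (intro tendsto_null_power smalloD_tendsto[OF large] K)
  then have lim: "(\<lambda>n. (2 * real k) ^ k * x n) \<longlonglongrightarrow> 0" by (rule tendsto_mult_right_zero)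
  have upper: "\<forall>\<^sub>F n in sequentially. ln (real n) / vertex_mean r n (p n) \<le> (2 * real k) ^ k * x n"
    using eventually_ge_at_top[of "2 * r"]
  proof eventually_elim
    case (elim n)
    have n: "n \<ge> 2" using elim r by simp
    have ln_power: "(ln (real n) powr (1 / real ?K)) ^ ?K = ln (real n)"
    proof -
      have pos: "ln (real n) > 0" using n by simp
      have "(ln (real n) powr (1 / real ?K)) ^ ?K = ln (real n) powr (real ?K * (1 / real ?K))"
        by (rule powr_power) (use pos in linarith)
      also have "real ?K * (1 / real ?K) = 1" using K by simp
      finally show ?thesis using pos by simp
    qed
    have n_power: "(real n powr (- 2 / real r)) ^ ?K = 1 / real n ^ k"
    proof -
      have "real ?K * (- 2 / real r) = - (2 * real ?K) / real r" by simp
      also have "\<dots> = - real k" unfolding two_choose_two k(2) using r by simp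
      finally have exponent: "real ?K * (- 2 / real r) = - real k" .
      have "(real n powr (- 2 / real r)) ^ ?K = real n powr (real ?K * (- 2 / real r))"
        by (rule powr_power) (use n in linarith)
      then have "(real n powr (- 2 / real r)) ^ ?K = real n powr (- real k)"
        by (simp only: exponent)
      then show ?thesis using n by (simp add: powr_minus_divide powr_realpow)
    qed
    have x: "x n = ln (real n) / (real n ^ k * p n ^ ?K)"
      unfolding x_def power_divide power_mult_distrib ln_power n_power by simp
    have "real n / (2 * real k) \<le> real (n - 1) / real k"
      using n k(1) by (simp add: divide_simps of_nat_diff)
    then have "(real n / (2 * real k)) ^ k \<le> (real (n - 1) / real k) ^ k"
      by (rule power_mono) simp
    also have "\<dots> \<le> real ((n - 1) choose k)"
    proof (rule binomial_ge_n_over_k_pow_k)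
      show "k \<le> n - 1" using elim by (simp add: k_def)
    qed
    finally have N: "(real n / (2 * real k)) ^ k \<le> real ((n - 1) choose k)" .
    show ?case
    proof (cases "p n = 0")
      case True
      then show ?thesis by (simp add: vertex_mean_def x zero_power[OF K])
    next
      case False
      then have q: "p n ^ ?K > 0" using p[of n] by simp
      have pos: "(real n / (2 * real k)) ^ k > 0" using n k(1) by simp
      have "ln (real n) / (real ((n - 1) choose k) * p n ^ ?K)
          \<le> ln (real n) / ((real n / (2 * real k)) ^ k * p n ^ ?K)"
      proof (rule divide_left_mono)
        show "(real n / (2 * real k)) ^ k * p n ^ ?K \<le> real ((n - 1) choose k) * p n ^ ?K"
          by (rule mult_right_mono[OF N less_imp_le[OF q]])
        show "0 \<le> ln (real n)" using n by simp
        show "0 < real ((n - 1) choose k) * p n ^ ?K * ((real n / (2 * real k)) ^ k * p n ^ ?K)"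
          by (intro mult_pos_pos pos q less_le_trans[OF pos N])
      qed
      also have "\<dots> = (2 * real k) ^ k * x n" by (simp add: x power_divide)
      finally show ?thesis by (simp add: vertex_mean_def k_def)
    qed
  qed
  have lower: "\<forall>\<^sub>F n in sequentially. 0 \<le> ln (real n) / vertex_mean r n (p n)"
    using eventually_ge_at_top[of 1] by eventually_elim (simp add: vertex_mean_def p)
  show ?thesis by (rule tendsto_sandwich[OF lower upper tendsto_const lim])
qed

text \<open>Positivity of \<open>p\<close> is what allows dividing by the mean in the definition of \<open>\<epsilon>\<close> below.\<close>

lemma eventually_pos_of_large:
  assumes p: "\<And>n. 0 \<le> p n"
    and large: "(\<lambda>n. real n powr (- 2 / real r) * ln (real n) powr (1 / real (r choose 2))) \<in> o(p)"
  shows "\<forall>\<^sub>F n in sequentially. 0 < p n"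
  using landau_o.smallD[OF large zero_less_one] eventually_ge_at_top[of 2]
proof eventually_elim
  case (elim n)
  have "0 < real n powr (- 2 / real r) * ln (real n) powr (1 / real (r choose 2))"
    using elim by simp
  then have "p n \<noteq> 0" using elim(1) by force
  then show ?case using p[of n] by simp
qed

lemma edge_prob_tendsto_0:
  assumes "p \<in> o(\<lambda>n. real n powr (- 2 / (real r + 1)))"
  shows "p \<longlonglongrightarrow> 0"
proof -
  have "(\<lambda>n. real n powr (- 2 / (real r + 1))) \<longlonglongrightarrow> 0"
    by (intro tendsto_neg_powr filterlim_real_sequentially) (simp add: field_simps)
  moreover have "\<forall>\<^sub>F n in sequentially. norm (p n) \<le> real n powr (- 2 / (real r + 1))"
    using landau_o.smallD[OF assms zero_less_one] by simp
  ultimately show ?thesis by (rule Lim_null_comparison[rotated])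
qed

text \<open>The error \<open>\<epsilon>\<close> is defined by solving the claimed equation for it. The two bounds on the tail then say
that \<open>\<bar>\<epsilon> n t\<bar> \<le> e n\<close> for a null sequence \<open>e\<close> that does not depend on \<open>t\<close>, which is the uniformity.
The four summands of \<open>e\<close> come from \<open>ln (1 - q)\<close>, from the correction in Janson's inequality, from
\<open>(n - t) choose (r - 1)\<close> against \<open>(n - 1) choose (r - 1)\<close>, and from the union bound.\<close>

lemma uncovered_tail:
  fixes p t0 :: "nat \<Rightarrow> real"
  assumes r: "2 \<le> r" and p: "\<And>n. 0 \<le> p n \<and> p n \<le> 1"
    and large: "(\<lambda>n. real n powr (- 2 / real r) * ln (real n) powr (1 / real (r choose 2))) \<in> o(p)"
    and small: "p \<in> o(\<lambda>n. real n powr (- 2 / (real r + 1)))"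
    and t0: "t0 \<in> o(\<lambda>n. real n)"
  shows "\<exists>\<epsilon> :: nat \<Rightarrow> nat \<Rightarrow> real.
    (\<forall>\<delta>>0. \<forall>\<^sub>F n in sequentially. \<forall>t. 1 \<le> t \<and> real t \<le> t0 n \<longrightarrow> \<bar>\<epsilon> n t\<bar> \<le> \<delta>) \<and>
    (\<forall>\<^sub>F n in sequentially. \<forall>t. 1 \<le> t \<and> real t \<le> t0 n \<longrightarrow>
      measure_pmf.prob (gnp n (p n)) {E. uncovered r n E \<ge> t} =
        exp (- (1 + \<epsilon> n t) * real t * real ((n - 1) choose (r - 1)) * p n ^ (r choose 2)))"
proof -
  let ?K = "r choose 2"
  define L where "L n = vertex_mean r n (p n)" for n
  define P where "P n t = measure_pmf.prob (gnp n (p n)) {E. uncovered r n E \<ge> t}" for n t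
  define q where "q n = p n ^ ?K" for n
  define w where "w n = overlap_weight r n (p n)" for n
  define e where "e n = 2 * q n + w n + real (r - 1) * (t0 n / real n) + ln (real n) / L n" for n
  define \<epsilon> where "\<epsilon> n t = - ln (P n t) / (real t * L n) - 1" for n t
  have K: "?K > 0" using r by simp
  have q0: "q \<longlonglongrightarrow> 0"
    unfolding q_def by (intro tendsto_null_power edge_prob_tendsto_0[OF small] K)
  have w0: "w \<longlonglongrightarrow> 0"
    unfolding w_def by (rule overlap_weight_tendsto_0[OF p small])
  have "e \<longlonglongrightarrow> 2 * 0 + 0 + real (r - 1) * 0 + 0"
    unfolding e_def L_def using p
    by (intro tendsto_add tendsto_mult tendsto_const q0 w0 smalloD_tendsto[OF t0]
      ln_over_vertex_mean_tendsto_0[OF r _ large]) auto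
  then have e0: "e \<longlonglongrightarrow> 0" by simp
  have q_small: "\<forall>\<^sub>F n in sequentially. q n < 1 / 2" by (rule order_tendstoD(2)[OF q0]) simp
  have w_small: "\<forall>\<^sub>F n in sequentially. w n < 1" by (rule order_tendstoD(2)[OF w0]) simp
  have t0_small: "\<forall>\<^sub>F n in sequentially. t0 n / real n < 1"
    by (rule order_tendstoD(2)[OF smalloD_tendsto[OF t0]]) simp
  have p_pos: "\<forall>\<^sub>F n in sequentially. 0 < p n"
    using p by (intro eventually_pos_of_large[OF _ large]) auto
  have main: "\<forall>\<^sub>F n in sequentially. \<forall>t. 1 \<le> t \<and> real t \<le> t0 n \<longrightarrow>
      P n t > 0 \<and> L n > 0 \<and> \<bar>\<epsilon> n t\<bar> \<le> e n"
    using q_small w_small t0_small p_pos eventually_ge_at_top[of r]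
  proof eventually_elim
    case (elim n)
    show ?case
    proof (intro allI impI)
      fix t assume t: "1 \<le> t \<and> real t \<le> t0 n"
      have n: "n > 0" using elim r by simp
      have "t0 n < real n" using elim n by (simp add: field_simps)
      then have tn: "t \<le> n" using t by linarith
      have q: "0 < q n" "q n \<le> 1 / 2" using elim by (auto simp: q_def)
      have L: "L n > 0" using elim n by (auto simp: L_def vertex_mean_def)
      have tL: "real t * L n > 0" using L t by simp
      have w: "0 \<le> w n" "w n \<le> 1"
        using elim p by (auto simp: w_def overlap_weight_def intro!: sum_nonneg)
      have lower: "exp (- ((1 + 2 * q n) * (real t * L n))) \<le> P n t"
        unfolding P_def q_def L_def vertex_mean_def
        using p q r tn by (intro prob_uncovered_ge_lower) (auto simp: q_def)
      then have P: "P n t > 0" using exp_gt_zero less_le_trans by blast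
      define b where "b = real (r - 1) * (real t / real n)"
      have b: "0 \<le> b" "b \<le> real (r - 1) * (t0 n / real n)"
        unfolding b_def using t n by (auto intro!: mult_left_mono divide_right_mono)
      have "P n t \<le> exp (real t * ln (real n) - (1 - w n) * ((1 - b) * (real t * L n)))"
        unfolding P_def w_def L_def vertex_mean_def b_def
        using prob_uncovered_ge_upper[of "p n" r n t] p[of n] w r t tn by (simp add: w_def)
      then have "ln (P n t) \<le> real t * ln (real n) - (1 - w n) * ((1 - b) * (real t * L n))"
        using P by (metis ln_exp ln_le_cancel_iff exp_gt_zero)
      then have "(1 - w n) * (1 - b) * (real t * L n) - real t * ln (real n) \<le> - ln (P n t)"
        by (simp add: mult.assoc)
      then have "((1 - w n) * (1 - b) * (real t * L n) - real t * ln (real n)) / (real t * L n)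
          \<le> - ln (P n t) / (real t * L n)"
        using tL by (intro divide_right_mono) auto
      then have "((1 - w n) * (1 - b) * (real t * L n) - real t * ln (real n)) / (real t * L n) \<le> 1 + \<epsilon> n t"
        by (simp add: \<epsilon>_def)
      moreover have "((1 - w n) * (1 - b) * (real t * L n) - real t * ln (real n)) / (real t * L n)
          = (1 - w n) * (1 - b) - ln (real n) / L n"
        using L t by (simp add: field_simps)
      moreover have "(1 - w n) * (1 - b) \<ge> 1 - w n - b"
        using mult_nonneg_nonneg[OF w(1) b(1)] by (simp add: algebra_simps)
      ultimately have "- \<epsilon> n t \<le> w n + b + ln (real n) / L n" by linarith
      then have 1: "- \<epsilon> n t \<le> e n" using b q by (simp add: e_def)
      have "- ((1 + 2 * q n) * (real t * L n)) \<le> ln (P n t)"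
        using lower P by (metis ln_exp ln_le_cancel_iff exp_gt_zero)
      then have "- ln (P n t) / (real t * L n) \<le> 1 + 2 * q n"
        unfolding pos_divide_le_eq[OF tL] by linarith
      moreover have "0 \<le> ln (real n) / L n" using n L by simp
      ultimately have "\<epsilon> n t \<le> e n" using b w by (simp add: \<epsilon>_def e_def)
      then show "P n t > 0 \<and> L n > 0 \<and> \<bar>\<epsilon> n t\<bar> \<le> e n" using 1 P L by simp
    qed
  qed
  show ?thesis
  proof (intro exI[of _ \<epsilon>] conjI allI impI)
    fix \<delta> :: real assume "\<delta> > 0"
    from main order_tendstoD(2)[OF e0 this]
    show "\<forall>\<^sub>F n in sequentially. \<forall>t. 1 \<le> t \<and> real t \<le> t0 n \<longrightarrow> \<bar>\<epsilon> n t\<bar> \<le> \<delta>"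
      by eventually_elim force
  next
    show "\<forall>\<^sub>F n in sequentially. \<forall>t. 1 \<le> t \<and> real t \<le> t0 n \<longrightarrow>
      measure_pmf.prob (gnp n (p n)) {E. uncovered r n E \<ge> t} =
        exp (- (1 + \<epsilon> n t) * real t * real ((n - 1) choose (r - 1)) * p n ^ ?K)"
      using main
    proof eventually_elim
      case (elim n)
      show ?case
      proof (intro allI impI)
        fix t assume t: "1 \<le> t \<and> real t \<le> t0 n"
        have "- (1 + \<epsilon> n t) * real t * real ((n - 1) choose (r - 1)) * p n ^ ?K = - (1 + \<epsilon> n t) * (real t * L n)"
          by (simp add: L_def vertex_mean_def)
        also have "\<dots> = ln (P n t)"
        proof -
          have "real t * L n \<noteq> 0" using elim t by fastforce
          then show ?thesis by (simp add: \<epsilon>_def)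
        qed
        finally show "measure_pmf.prob (gnp n (p n)) {E. uncovered r n E \<ge> t} =
            exp (- (1 + \<epsilon> n t) * real t * real ((n - 1) choose (r - 1)) * p n ^ ?K)"
          using elim t by (simp add: P_def)
      qed
    qed
  qed
qed

text \<open>The case \<open>t = s + 1\<close> of the tail bound. In the constant, \<open>r\<close> comes from \<open>r * mu r n p / n\<close> being
the mean number of cliques at a vertex, and \<open>2\<close> from \<open>1 + 2 * q \<le> 2\<close>.\<close>

lemma prob_no_factor_ge:
  assumes p: "0 \<le> p" "p \<le> 1" and q: "p ^ (r choose 2) \<le> 1 / 2" and "0 < r" "s < n" "r dvd n - s"
  shows "exp (- (2 * real r) * ((real s + 1) * (mu r n p / real n)))
    \<le> measure_pmf.prob (gnp n p) {E. num_factors r s n E = 0}"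
proof -
  let ?L = "real ((n - 1) choose (r - 1)) * p ^ (r choose 2)"
  have "r * (n choose r) = n * ((n - 1) choose (r - 1))"
    using assms by (intro times_binomial_minus1_eq) auto
  then have "real r * real (n choose r) = real n * real ((n - 1) choose (r - 1))"
    by (metis of_nat_mult)
  then have "real r * (mu r n p / real n) = ?L"
    using assms by (simp add: mu_def field_simps)
  moreover have "2 * real r * ((real s + 1) * (mu r n p / real n))
      = 2 * (real (Suc s) * (real r * (mu r n p / real n)))"
    by simp
  ultimately have "2 * real r * ((real s + 1) * (mu r n p / real n)) = 2 * (real (Suc s) * ?L)"
    by (simp only:)
  moreover have "(1 + 2 * p ^ (r choose 2)) * (real (Suc s) * ?L) \<le> 2 * (real (Suc s) * ?L)"
    using p q by (intro mult_right_mono) auto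
  ultimately have "exp (- (2 * real r) * ((real s + 1) * (mu r n p / real n)))
      \<le> exp (- ((1 + 2 * p ^ (r choose 2)) * (real (Suc s) * ?L)))"
    by simp
  also have "\<dots> \<le> measure_pmf.prob (gnp n p) {E. uncovered r n E \<ge> Suc s}"
    using assms by (intro prob_uncovered_ge_lower) auto
  also have "\<dots> \<le> measure_pmf.prob (gnp n p) {E. num_factors r s n E = 0}"
    using assms by (intro measure_pmf.finite_measure_mono) (auto intro: num_factors_eq_0)
  finally show ?thesis .
qed

lemma eventually_prob_no_factor_ge:
  fixes p :: "nat \<Rightarrow> real" and s :: "nat \<Rightarrow> nat"
  assumes r: "2 \<le> r" and p: "\<And>n. 0 \<le> p n \<and> p n \<le> 1" and p0: "p \<longlonglongrightarrow> 0"
    and s: "(\<lambda>n. real (s n)) \<in> o(\<lambda>n. real n)"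
  shows "\<forall>\<^sub>F n in sequentially. int r dvd int n - int (s n) \<longrightarrow>
    measure_pmf.prob (gnp n (p n)) {E. num_factors r (s n) n E = 0} \<ge>
      exp (- (2 * real r) * ((real (s n) + 1) * (mu r n (p n) / real n)))"
proof -
  have q0: "(\<lambda>n. p n ^ (r choose 2)) \<longlonglongrightarrow> 0"
    using r by (intro tendsto_null_power p0) simp
  have "\<forall>\<^sub>F n in sequentially. p n ^ (r choose 2) < 1 / 2" by (rule order_tendstoD(2)[OF q0]) simp
  moreover have "\<forall>\<^sub>F n in sequentially. real (s n) / real n < 1"
    by (rule order_tendstoD(2)[OF smalloD_tendsto[OF s]]) simp
  ultimately show ?thesis using eventually_gt_at_top[of 0]
  proof eventually_elim
    case (elim n)
    show ?case
    proof
      assume dvd: "int r dvd int n - int (s n)"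
      have "real (s n) < real n" using elim by (simp add: field_simps)
      then have sn: "s n < n" by simp
      then have "int r dvd int (n - s n)" using dvd by (simp add: of_nat_diff)
      then have "r dvd n - s n" by simp
      then show "measure_pmf.prob (gnp n (p n)) {E. num_factors r (s n) n E = 0} \<ge>
          exp (- (2 * real r) * ((real (s n) + 1) * (mu r n (p n) / real n)))"
        using elim p[of n] sn r by (intro prob_no_factor_ge) auto
    qed
  qed
qed

theorem proposition3p1:
  fixes r :: nat
  assumes "r \<ge> 3"
  shows "\<exists>C>0. \<forall>p :: nat \<Rightarrow> real.
    (\<forall>n. 0 \<le> p n \<and> p n \<le> 1) \<and>
    (\<lambda>n. real n powr (- 2 / real r) * ln (real n) powr (1 / real (r choose 2))) \<in> o(p) \<and>
    p \<in> o(\<lambda>n. real n powr (- 2 / (real r + 1)))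
    \<longrightarrow>
    (\<forall>t0 :: nat \<Rightarrow> real. t0 \<in> o(\<lambda>n. real n) \<longrightarrow>
      (\<exists>\<epsilon> :: nat \<Rightarrow> nat \<Rightarrow> real.
        (\<forall>\<delta>>0. \<forall>\<^sub>F n in sequentially. \<forall>t. 1 \<le> t \<and> real t \<le> t0 n \<longrightarrow> \<bar>\<epsilon> n t\<bar> \<le> \<delta>) \<and>
        (\<forall>\<^sub>F n in sequentially. \<forall>t. 1 \<le> t \<and> real t \<le> t0 n \<longrightarrow>
          measure_pmf.prob (gnp n (p n)) {E. uncovered r n E \<ge> t} =
            exp (- (1 + \<epsilon> n t) * real t * real ((n - 1) choose (r - 1)) * p n ^ (r choose 2)))))
    \<and>
    (\<forall>s :: nat \<Rightarrow> nat. (\<lambda>n. real (s n)) \<in> o(\<lambda>n. real n) \<longrightarrow>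
      (\<forall>\<^sub>F n in sequentially. int r dvd int n - int (s n) \<longrightarrow>
        measure_pmf.prob (gnp n (p n)) {E. num_factors r (s n) n E = 0} \<ge>
          exp (- C * ((real (s n) + 1) * (mu r n (p n) / real n)))))"
  using assms
  by (intro exI[of _ "2 * real r"] conjI allI impI uncovered_tail eventually_prob_no_factor_ge
      edge_prob_tendsto_0[of _ r]) auto

end
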